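(* Let $\mathcal{C}$ be a finitely aligned left cancellative small category, let $B$ be a $C^*$-algebra, and let $T\colon\mathcal{C}\to B$ be a map. Then $T$ is a representation of $\mathcal{C}$ in $B$ if and only if it satisfies the following conditions: (Exe 1) $T_\alpha$ is a partial isometry for every $\alpha\in\mathcal{C}$; (Exe 2) for all $\alpha,\beta\in\mathcal{C}$, $T_\alpha T_\beta=T_{\alpha\beta}$ if $s(\alpha)=r(\beta)$, and $T_\alpha T_\beta=0$ otherwise; (Exe 3) the family of initial projections $\{T_\alpha^*T_\alpha:\alpha\in\mathcal{C}\}$ commutes, as does the family of final projections $\{T_\alpha T_\alpha^*:\alpha\in\mathcal{C}\}$; (Exe 4) $T_\alpha T_\alpha^*T_\beta T_\beta^*=0$ if $\alpha\mathcal{C}\cap\beta\mathcal{C}=\varnothing$; (Exe 5) $T_\alpha^*T_\alpha\ge T_\beta T_\beta^*$ if $s(\alpha)=r(\beta)$; (Exe 6) $T_\alpha T_\alpha^*T_\beta T_\beta^*=\bigvee_{\gamma\in\alpha\vee\beta}T_\gamma T_\gamma^*$ for all $\alpha,\beta\in\mathcal{C}$.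
   Context: Small categories: a small category $\mathcal{C}$ is identified with its set of morphisms; $\mathcal{C}^0\subseteq\mathcal{C}$ (nonempty) is the set of vertices (objects, identified with identity morphisms), $r,s\colon\mathcal{C}\to\mathcal{C}^0$ are the range and source maps, and $\alpha\beta$ is defined iff $s(\alpha)=r(\beta)$. $\mathcal{C}$ is left cancellative if $\alpha\beta=\alpha\gamma$ implies $\beta=\gamma$. Write $\alpha\mathcal{C}=\{\alpha\beta: r(\beta)=s(\alpha)\}$. $\mathcal{C}$ is finitely aligned if for all $\alpha,\beta\in\mathcal{C}$ there is a finite (possibly empty) $F\subseteq\mathcal{C}$ with $\alpha\mathcal{C}\cap\beta\mathcal{C}=\bigcup_{\gamma\in F}\gamma\mathcal{C}$. A set $F$ is independent if $\gamma\notin\gamma'\mathcal{C}$ for all distinct $\gamma,\gamma'\in F$. One writes $\alpha\vee\beta$ for any finite independent $F$ with $\alpha\mathcal{C}\cap\beta\mathcal{C}=\bigcup_{\gamma\in F}\gamma\mathcal{C}$; it is unique up to replacing elements $\gamma$ by $\gamma\delta$ with $\delta$ invertible. A representation of $\mathcal{C}$ in a $C^*$-algebra $B$ is a map $T\colon\mathcal{C}\to B$ such that for all $\alpha,\beta\in\mathcal{C}$: (1) $T_\alpha^*T_\alpha=T_{s(\alpha)}$; (2) $T_\alpha T_\beta=T_{\alpha\beta}$ if $s(\alpha)=r(\beta)$; (3) $T_\alpha T_\alpha^*T_\beta T_\beta^*=\bigvee_{\gamma\in\alpha\vee\beta}T_\gamma T_\gamma^*$. Joins of projections are a priori taken in $B^{**}$,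 and the empty join is $0$. *)

theory Defs
  imports "HOL-Analysis.Analysis"
begin

section \<open>C*-algebras\<close>

class scaleC =
  fixes scaleC :: "complex \<Rightarrow> 'a \<Rightarrow> 'a" (infixr "*\<^sub>C" 75)

class adj =
  fixes adj :: "'a \<Rightarrow> 'a"

text \<open>Complex C*-algebras, not assumed to be unital or nonzero. The complex scalar
  multiplication extends the real one of \<^class>\<open>real_normed_algebra\<close>.\<close>

class cstar_algebra = real_normed_algebra + banach + scaleC + adj +
  assumes scaleC_of_real: "complex_of_real t *\<^sub>C x = t *\<^sub>R x"
    and scaleC_add_right: "z *\<^sub>C (x + y) = z *\<^sub>C x + z *\<^sub>C y"
    and scaleC_add_left: "(z + w) *\<^sub>C x = z *\<^sub>C x + w *\<^sub>C x"
    and scaleC_scaleC: "z *\<^sub>C w *\<^sub>C x = (z * w) *\<^sub>C x"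
    and mult_scaleC_left: "(z *\<^sub>C x) * y = z *\<^sub>C (x * y)"
    and mult_scaleC_right: "x * (z *\<^sub>C y) = z *\<^sub>C (x * y)"
    and norm_scaleC: "norm (z *\<^sub>C x) = cmod z * norm x"
    and adj_adj: "adj (adj x) = x"
    and adj_add: "adj (x + y) = adj x + adj y"
    and adj_scaleC: "adj (z *\<^sub>C x) = cnj z *\<^sub>C adj x"
    and adj_mult: "adj (x * y) = adj y * adj x"
    and cstar_identity: "norm (adj x * x) = norm x ^ 2"

text \<open>The next notions only mention the algebraic operations, so that they apply both to a
  C*-algebra and to its bidual. The order is the C*-order: \<open>a \<le> b\<close> iff \<open>b - a\<close> is
  positive, that is, of the form \<open>c\<^sup>*c\<close>.\<close>

definition is_projection :: "'a::{times,adj} \<Rightarrow> bool" where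
  "is_projection p \<longleftrightarrow> p * p = p \<and> adj p = p"

definition cstar_le :: "'a::{times,minus,adj} \<Rightarrow> 'a \<Rightarrow> bool" where
  "cstar_le a b \<longleftrightarrow> (\<exists>c. b - a = adj c * c)"

definition is_partial_isometry :: "'a::{times,adj} \<Rightarrow> bool" where
  "is_partial_isometry u \<longleftrightarrow> u * adj u * u = u"

text \<open>\<open>is_join P p\<close>: \<open>p\<close> is the join of the set \<open>P\<close> in the projection lattice, with the
  convention that the empty join is \<open>0\<close>.\<close>

definition is_join :: "'a::{zero,times,minus,adj} set \<Rightarrow> 'a \<Rightarrow> bool" where
  "is_join P p \<longleftrightarrow>
     (if P = {} then p = 0
      else is_projection p \<and> (\<forall>q\<in>P. cstar_le q p) \<and>
           (\<forall>e. is_projection e \<and> (\<forall>q\<in>P. cstar_le q e) \<longrightarrow> cstar_le p e))"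


section \<open>The bidual of a C*-algebra\<close>

text \<open>Boundedness is with respect to the norm \<open>N\<close>.\<close>

definition bounded_clinear ::
  "('a::{plus,scaleC} \<Rightarrow> real) \<Rightarrow> ('a \<Rightarrow> complex) \<Rightarrow> bool" where
  "bounded_clinear N f \<longleftrightarrow>
     (\<forall>x y. f (x + y) = f x + f y) \<and>
     (\<forall>z x. f (z *\<^sub>C x) = z * f x) \<and>
     (\<exists>K. \<forall>x. cmod (f x) \<le> N x * K)"

lemma bounded_clinearI:
  assumes "\<And>x. cmod (f x) \<le> N x * K"
    and "\<And>x y. f (x + y) = f x + f y" and "\<And>z x. f (z *\<^sub>C x) = z * f x"
  shows "bounded_clinear N f"
  using assms unfolding bounded_clinear_def by blast

lemma bounded_clinear_bounded_linear:
  fixes f :: "'a::cstar_algebra \<Rightarrow> complex"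
  assumes "bounded_clinear norm f"
  shows "bounded_linear f"
proof -
  have "f (t *\<^sub>R x) = t *\<^sub>R f x" for t x
    using assms unfolding bounded_clinear_def
    by (metis scaleC_of_real scaleR_conv_of_real)
  then show ?thesis
    using assms unfolding bounded_clinear_def
    by (auto intro!: bounded_linear_intro)
qed

lemma norm_adj: "norm (adj x) = norm (x::'a::cstar_algebra)"
proof -
  have le: "norm y \<le> norm (adj y)" for y :: 'a
  proof (cases "norm y = 0")
    case False
    have "norm y * norm y \<le> norm (adj y) * norm y"
      using cstar_identity[of y] norm_mult_ineq[of "adj y" y] by (simp add: power2_eq_square)
    then show ?thesis
      using False by (simp add: mult_le_cancel_right)
  qed simp
  from le[of x] le[of "adj x"] show ?thesis
    by (simp add: adj_adj)
qed

typedef (overloaded) 'a cdual =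
  "{f :: 'a::cstar_algebra \<Rightarrow> complex. bounded_clinear norm f}"
  morphisms cdual_apply Abs_cdual
  by (rule exI[of _ "\<lambda>_. 0"]) (auto simp: bounded_clinear_def intro: exI[of _ 0])

setup_lifting type_definition_cdual

instantiation cdual :: (cstar_algebra) "{plus,scaleC}"
begin

lift_definition plus_cdual :: "'a cdual \<Rightarrow> 'a cdual \<Rightarrow> 'a cdual"
  is "\<lambda>f g x. f x + g x"
proof -
  fix f g :: "'a \<Rightarrow> complex"
  assume f: "bounded_clinear norm f" and g: "bounded_clinear norm g"
  obtain K L where K: "\<And>x. cmod (f x) \<le> norm x * K" and L: "\<And>x. cmod (g x) \<le> norm x * L"
    using f g unfolding bounded_clinear_def by auto
  have b: "cmod (f x + g x) \<le> norm x * (K + L)" for x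
    using norm_triangle_ineq[of "f x" "g x"] K[of x] L[of x] by (simp add: distrib_left)
  show "bounded_clinear norm (\<lambda>x. f x + g x)"
    by (rule bounded_clinearI, rule b) (use f g in \<open>auto simp: bounded_clinear_def algebra_simps\<close>)
qed

lift_definition scaleC_cdual :: "complex \<Rightarrow> 'a cdual \<Rightarrow> 'a cdual"
  is "\<lambda>z f x. z * f x"
proof -
  fix z and f :: "'a \<Rightarrow> complex"
  assume f: "bounded_clinear norm f"
  obtain K where K: "\<And>x. cmod (f x) \<le> norm x * K"
    using f unfolding bounded_clinear_def by auto
  have b: "cmod (z * f x) \<le> norm x * (cmod z * K)" for x
    using mult_left_mono[OF K[of x], of "cmod z"] by (simp add: norm_mult algebra_simps)
  show "bounded_clinear norm (\<lambda>x. z * f x)"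
    by (rule bounded_clinearI, rule b) (use f in \<open>auto simp: bounded_clinear_def algebra_simps\<close>)
qed

instance ..

end

lift_definition norm_cdual :: "'a::cstar_algebra cdual \<Rightarrow> real" is onorm .

lemma cdual_apply_bound: "cmod (cdual_apply f x) \<le> norm_cdual f * norm x"
  by transfer (auto intro: onorm bounded_clinear_bounded_linear)

lemma norm_cdual_nonneg: "0 \<le> norm_cdual (f :: 'a::cstar_algebra cdual)"
  by transfer (auto intro: onorm_pos_le bounded_clinear_bounded_linear)

lemma norm_cdual_le:
  assumes "0 \<le> K" "\<And>x. cmod (cdual_apply f x) \<le> K * norm x"
  shows "norm_cdual f \<le> K"
  using assms by transfer (auto intro: onorm_bound)

typedef (overloaded) 'a bidual =
  "{m :: 'a::cstar_algebra cdual \<Rightarrow> complex. bounded_clinear norm_cdual m}"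
  morphisms bidual_apply Abs_bidual
  by (rule exI[of _ "\<lambda>_. 0"]) (auto simp: bounded_clinear_def intro: exI[of _ 0])

setup_lifting type_definition_bidual

lemma bidual_apply_bounded:
  obtains K where "0 \<le> K" "\<And>f. cmod (bidual_apply m f) \<le> norm_cdual f * K"
proof -
  obtain K where K: "\<And>f. cmod (bidual_apply m f) \<le> norm_cdual f * K"
    using bidual_apply[of m] unfolding bounded_clinear_def by auto
  have "cmod (bidual_apply m f) \<le> norm_cdual f * \<bar>K\<bar>" for f
    using order_trans[OF K mult_left_mono[OF abs_ge_self norm_cdual_nonneg]] .
  then show thesis
    using that[of "\<bar>K\<bar>"] by simp
qed

lemma bidual_apply_add: "bidual_apply m (f + g) = bidual_apply m f + bidual_apply m g"
  using bidual_apply[of m] by (auto simp: bounded_clinear_def)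

lemma bidual_apply_scaleC: "bidual_apply m (z *\<^sub>C f) = z * bidual_apply m f"
  using bidual_apply[of m] by (auto simp: bounded_clinear_def)

lift_definition to_bidual :: "'a::cstar_algebra \<Rightarrow> 'a bidual" is "\<lambda>x f. cdual_apply f x"
proof -
  fix x :: 'a
  show "bounded_clinear norm_cdual (\<lambda>f. cdual_apply f x)"
    unfolding bounded_clinear_def
    by (auto simp: plus_cdual.rep_eq scaleC_cdual.rep_eq intro!: exI[of _ "norm x"]
        cdual_apply_bound)
qed

lift_definition cdual_adj :: "'a::cstar_algebra cdual \<Rightarrow> 'a cdual"
  is "\<lambda>f x. cnj (f (adj x))"
proof -
  fix f :: "'a \<Rightarrow> complex"
  assume "bounded_clinear norm f"
  then show "bounded_clinear norm (\<lambda>x. cnj (f (adj x)))"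
    unfolding bounded_clinear_def
    by (auto simp: adj_add adj_scaleC) (metis norm_adj)
qed

text \<open>The two module actions behind the (first) Arens product:
  \<open>(f \<cdot> x)(y) = f(xy)\<close> and \<open>(n \<cdot> f)(x) = n(f \<cdot> x)\<close>.\<close>

lift_definition cdual_act :: "'a::cstar_algebra cdual \<Rightarrow> 'a \<Rightarrow> 'a cdual"
  is "\<lambda>f x y. f (x * y)"
proof -
  fix f :: "'a \<Rightarrow> complex" and x :: 'a
  assume f: "bounded_clinear norm f"
  have b: "cmod (f (x * y)) \<le> norm y * (onorm f * norm x)" for y
  proof -
    have "cmod (f (x * y)) \<le> onorm f * norm (x * y)"
      by (rule onorm[OF bounded_clinear_bounded_linear[OF f]])
    also have "\<dots> \<le> onorm f * (norm x * norm y)"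
      by (intro mult_left_mono norm_mult_ineq onorm_pos_le bounded_clinear_bounded_linear f)
    finally show ?thesis
      by (simp add: algebra_simps)
  qed
  show "bounded_clinear norm (\<lambda>y. f (x * y))"
    by (rule bounded_clinearI, rule b) (use f in \<open>auto simp: bounded_clinear_def distrib_left mult_scaleC_right\<close>)
qed

lemma cdual_act_add: "cdual_act f (x + y) = cdual_act f x + cdual_act f y"
  by transfer (auto simp: bounded_clinear_def distrib_right)

lemma cdual_act_scaleC: "cdual_act f (z *\<^sub>C x) = z *\<^sub>C cdual_act f x"
  by transfer (auto simp: bounded_clinear_def mult_scaleC_left)

lemma cdual_act_add_left: "cdual_act (f + g) x = cdual_act f x + cdual_act g x"
  by transfer auto

lemma cdual_act_scaleC_left: "cdual_act (z *\<^sub>C f) x = z *\<^sub>C cdual_act f x"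
  by transfer auto

lemma norm_cdual_act: "norm_cdual (cdual_act f x) \<le> norm_cdual f * norm x"
proof (rule norm_cdual_le)
  fix y
  have "cmod (cdual_apply (cdual_act f x) y) \<le> norm_cdual f * norm (x * y)"
    by (simp add: cdual_act.rep_eq cdual_apply_bound)
  also have "\<dots> \<le> norm_cdual f * (norm x * norm y)"
    by (intro mult_left_mono norm_mult_ineq norm_cdual_nonneg)
  finally show "cmod (cdual_apply (cdual_act f x) y) \<le> norm_cdual f * norm x * norm y"
    by (simp add: algebra_simps)
qed (simp add: norm_cdual_nonneg)

lift_definition bidual_act :: "'a::cstar_algebra bidual \<Rightarrow> 'a cdual \<Rightarrow> 'a cdual"
  is "\<lambda>n f x. bidual_apply n (cdual_act f x)"
proof -
  fix n :: "'a bidual" and f :: "'a cdual"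
  obtain K where K: "0 \<le> K" "\<And>f. cmod (bidual_apply n f) \<le> norm_cdual f * K"
    using bidual_apply_bounded by blast
  have b: "cmod (bidual_apply n (cdual_act f x)) \<le> norm x * (norm_cdual f * K)" for x
    using order_trans[OF K(2) mult_right_mono[OF norm_cdual_act K(1)]]
    by (simp add: algebra_simps)
  show "bounded_clinear norm (\<lambda>x. bidual_apply n (cdual_act f x))"
    by (rule bounded_clinearI, rule b)
      (auto simp: cdual_act_add cdual_act_scaleC bidual_apply_add bidual_apply_scaleC)
qed

lemma bidual_act_add: "bidual_act n (f + g) = bidual_act n f + bidual_act n g"
  by transfer (auto simp: cdual_act_add_left bidual_apply_add)

lemma bidual_act_scaleC: "bidual_act n (z *\<^sub>C f) = z *\<^sub>C bidual_act n f"
  by transfer (auto simp: cdual_act_scaleC_left bidual_apply_scaleC)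

lemma norm_cdual_adj: "norm_cdual (cdual_adj f) \<le> norm_cdual f"
  using cdual_apply_bound[of f "adj x" for x]
  by (intro norm_cdual_le) (auto simp: cdual_adj.rep_eq norm_cdual_nonneg norm_adj)

text \<open>With the following operations the bidual is the enveloping von Neumann algebra: the Arens product
  \<open>(mn)(f) = m(n \<cdot> f)\<close> and the involution \<open>m\<^sup>*(f)\<close> = complex conjugate of \<open>m(f\<^sup>*)\<close>.\<close>

instantiation bidual :: (cstar_algebra) "{zero,minus,times,adj}"
begin

lift_definition zero_bidual :: "'a bidual" is "\<lambda>_. 0"
  by (auto simp: bounded_clinear_def intro: exI[of _ 0])

lift_definition minus_bidual :: "'a bidual \<Rightarrow> 'a bidual \<Rightarrow> 'a bidual"
  is "\<lambda>m n f. m f - n f"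
proof -
  fix m n :: "'a cdual \<Rightarrow> complex"
  assume m: "bounded_clinear norm_cdual m" and n: "bounded_clinear norm_cdual n"
  obtain K L where K: "\<And>x. cmod (m x) \<le> norm_cdual x * K" and L: "\<And>x. cmod (n x) \<le> norm_cdual x * L"
    using m n unfolding bounded_clinear_def by auto
  have b: "cmod (m x - n x) \<le> norm_cdual x * (K + L)" for x
    using norm_triangle_ineq4[of "m x" "n x"] K[of x] L[of x] by (simp add: distrib_left)
  show "bounded_clinear norm_cdual (\<lambda>f. m f - n f)"
    by (rule bounded_clinearI, rule b) (use m n in \<open>auto simp: bounded_clinear_def algebra_simps\<close>)
qed

lift_definition times_bidual :: "'a bidual \<Rightarrow> 'a bidual \<Rightarrow> 'a bidual"
  is "\<lambda>m n f. bidual_apply m (bidual_act n f)"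
proof -
  fix m n :: "'a bidual"
  obtain K where K: "0 \<le> K" "\<And>f. cmod (bidual_apply m f) \<le> norm_cdual f * K"
    using bidual_apply_bounded by blast
  obtain L where L: "0 \<le> L" "\<And>f. cmod (bidual_apply n f) \<le> norm_cdual f * L"
    using bidual_apply_bounded by blast
  have bd: "norm_cdual (bidual_act n f) \<le> norm_cdual f * L" for f
  proof (rule norm_cdual_le)
    fix x
    have "cmod (cdual_apply (bidual_act n f) x) \<le> norm_cdual (cdual_act f x) * L"
      by (simp add: bidual_act.rep_eq L)
    also have "\<dots> \<le> norm_cdual f * norm x * L"
      by (intro mult_right_mono norm_cdual_act L)
    finally show "cmod (cdual_apply (bidual_act n f) x) \<le> norm_cdual f * L * norm x"
      by (simp add: algebra_simps)
  qed (simp add: norm_cdual_nonneg L)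
  have b: "cmod (bidual_apply m (bidual_act n f)) \<le> norm_cdual f * (L * K)" for f
    using order_trans[OF K(2) mult_right_mono[OF bd K(1)]] by (simp add: algebra_simps)
  show "bounded_clinear norm_cdual (\<lambda>f. bidual_apply m (bidual_act n f))"
    by (rule bounded_clinearI, rule b)
      (auto simp: bidual_act_add bidual_act_scaleC bidual_apply_add bidual_apply_scaleC)
qed

lift_definition adj_bidual :: "'a bidual \<Rightarrow> 'a bidual"
  is "\<lambda>m f. cnj (bidual_apply m (cdual_adj f))"
proof -
  fix m :: "'a bidual"
  obtain K where K: "0 \<le> K" "\<And>f. cmod (bidual_apply m f) \<le> norm_cdual f * K"
    using bidual_apply_bounded by blast
  have add: "cdual_adj (f + g) = cdual_adj f + cdual_adj g" for f g :: "'a cdual"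
    by transfer auto
  have scale: "cdual_adj (z *\<^sub>C f) = cnj z *\<^sub>C cdual_adj f" for z and f :: "'a cdual"
    by transfer auto
  have b: "cmod (cnj (bidual_apply m (cdual_adj f))) \<le> norm_cdual f * K" for f
    using order_trans[OF K(2) mult_right_mono[OF norm_cdual_adj K(1)]] by simp
  show
    "bounded_clinear norm_cdual (\<lambda>f. cnj (bidual_apply m (cdual_adj f)))"
    by (rule bounded_clinearI, rule b)
      (auto simp: add scale bidual_apply_add bidual_apply_scaleC)
qed

instance ..

end


section \<open>Left cancellative small categories\<close>

text \<open>\<open>cmp \<C> \<alpha> \<beta>\<close> is the composite \<open>\<alpha>\<beta>\<close>; its value is unconstrained unless
  \<open>src \<C> \<alpha> = rng \<C> \<beta>\<close>.\<close>

record 'c cat =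
  mor :: "'c set"
  obj :: "'c set"
  rng :: "'c \<Rightarrow> 'c"
  src :: "'c \<Rightarrow> 'c"
  cmp :: "'c \<Rightarrow> 'c \<Rightarrow> 'c"

definition small_category :: "'c cat \<Rightarrow> bool" where
  "small_category \<C> \<longleftrightarrow>
     obj \<C> \<noteq> {} \<and> obj \<C> \<subseteq> mor \<C> \<and>
     rng \<C> \<in> mor \<C> \<rightarrow> obj \<C> \<and> src \<C> \<in> mor \<C> \<rightarrow> obj \<C> \<and>
     (\<forall>v\<in>obj \<C>. rng \<C> v = v \<and> src \<C> v = v) \<and>
     (\<forall>\<alpha>\<in>mor \<C>. \<forall>\<beta>\<in>mor \<C>. src \<C> \<alpha> = rng \<C> \<beta> \<longrightarrow>
        cmp \<C> \<alpha> \<beta> \<in> mor \<C> \<and>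
        rng \<C> (cmp \<C> \<alpha> \<beta>) = rng \<C> \<alpha> \<and> src \<C> (cmp \<C> \<alpha> \<beta>) = src \<C> \<beta>) \<and>
     (\<forall>\<alpha>\<in>mor \<C>. cmp \<C> (rng \<C> \<alpha>) \<alpha> = \<alpha> \<and> cmp \<C> \<alpha> (src \<C> \<alpha>) = \<alpha>) \<and>
     (\<forall>\<alpha>\<in>mor \<C>. \<forall>\<beta>\<in>mor \<C>. \<forall>\<gamma>\<in>mor \<C>. src \<C> \<alpha> = rng \<C> \<beta> \<and> src \<C> \<beta> = rng \<C> \<gamma> \<longrightarrow>
        cmp \<C> (cmp \<C> \<alpha> \<beta>) \<gamma> = cmp \<C> \<alpha> (cmp \<C> \<beta> \<gamma>))"

definition left_cancellative :: "'c cat \<Rightarrow> bool" where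
  "left_cancellative \<C> \<longleftrightarrow>
     (\<forall>\<alpha>\<in>mor \<C>. \<forall>\<beta>\<in>mor \<C>. \<forall>\<gamma>\<in>mor \<C>.
        src \<C> \<alpha> = rng \<C> \<beta> \<and> src \<C> \<alpha> = rng \<C> \<gamma> \<and> cmp \<C> \<alpha> \<beta> = cmp \<C> \<alpha> \<gamma> \<longrightarrow> \<beta> = \<gamma>)"

definition extensions :: "'c cat \<Rightarrow> 'c \<Rightarrow> 'c set" where
  "extensions \<C> \<alpha> = {cmp \<C> \<alpha> \<beta> |\<beta>. \<beta> \<in> mor \<C> \<and> rng \<C> \<beta> = src \<C> \<alpha>}"

definition finitely_aligned :: "'c cat \<Rightarrow> bool" where
  "finitely_aligned \<C> \<longleftrightarrow>
     (\<forall>\<alpha>\<in>mor \<C>. \<forall>\<beta>\<in>mor \<C>. \<exists>F. finite F \<and> F \<subseteq> mor \<C> \<and>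
        extensions \<C> \<alpha> \<inter> extensions \<C> \<beta> = (\<Union>\<gamma>\<in>F. extensions \<C> \<gamma>))"

definition independent_set :: "'c cat \<Rightarrow> 'c set \<Rightarrow> bool" where
  "independent_set \<C> F \<longleftrightarrow> (\<forall>\<gamma>\<in>F. \<forall>\<gamma>'\<in>F. \<gamma> \<noteq> \<gamma>' \<longrightarrow> \<gamma> \<notin> extensions \<C> \<gamma>')"

text \<open>\<open>is_vee \<C> \<alpha> \<beta> F\<close>: the set \<open>F\<close> is an admissible choice for \<open>\<alpha> \<or> \<beta>\<close>, which is
  determined only up to multiplying its elements on the right by invertibles.\<close>

definition is_vee :: "'c cat \<Rightarrow> 'c \<Rightarrow> 'c \<Rightarrow> 'c set \<Rightarrow> bool" where
  "is_vee \<C> \<alpha> \<beta> F \<longleftrightarrow> finite F \<and> F \<subseteq> mor \<C> \<and> independent_set \<C> F \<and>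
     extensions \<C> \<alpha> \<inter> extensions \<C> \<beta> = (\<Union>\<gamma>\<in>F. extensions \<C> \<gamma>)"


section \<open>Representations\<close>

text \<open>\<open>T\<^sub>\<alpha>T\<^sub>\<alpha>\<^sup>*T\<^sub>\<beta>T\<^sub>\<beta>\<^sup>*\<close> is the join, taken in the bidual, of the \<open>T\<^sub>\<gamma>T\<^sub>\<gamma>\<^sup>*\<close> for
  \<open>\<gamma> \<in> \<alpha> \<or> \<beta>\<close>, for every choice of \<open>\<alpha> \<or> \<beta>\<close>.\<close>

definition join_condition ::
  "'c cat \<Rightarrow> ('c \<Rightarrow> 'b::cstar_algebra) \<Rightarrow> 'c \<Rightarrow> 'c \<Rightarrow> bool" where
  "join_condition \<C> T \<alpha> \<beta> \<longleftrightarrow>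
     (\<forall>F. is_vee \<C> \<alpha> \<beta> F \<longrightarrow>
        is_join ((\<lambda>\<gamma>. to_bidual (T \<gamma> * adj (T \<gamma>))) ` F)
          (to_bidual (T \<alpha> * adj (T \<alpha>) * (T \<beta> * adj (T \<beta>)))))"

definition is_representation :: "'c cat \<Rightarrow> ('c \<Rightarrow> 'b::cstar_algebra) \<Rightarrow> bool" where
  "is_representation \<C> T \<longleftrightarrow>
     (\<forall>\<alpha>\<in>mor \<C>. adj (T \<alpha>) * T \<alpha> = T (src \<C> \<alpha>)) \<and>
     (\<forall>\<alpha>\<in>mor \<C>. \<forall>\<beta>\<in>mor \<C>. src \<C> \<alpha> = rng \<C> \<beta> \<longrightarrow> T \<alpha> * T \<beta> = T (cmp \<C> \<alpha> \<beta>)) \<and>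
     (\<forall>\<alpha>\<in>mor \<C>. \<forall>\<beta>\<in>mor \<C>. join_condition \<C> T \<alpha> \<beta>)"

end

theory Submission
  imports Defs
begin

text \<open>
  Suppose \<open>T\<close> is a representation. The elements \<open>T\<^sub>v\<close> at vertices are projections, since
  \<open>T\<^sub>v = T\<^sub>v\<^sup>*T\<^sub>v\<close>, and this makes the \<open>T\<^sub>\<alpha>\<close> partial isometries satisfying the domination
  condition. For the vanishing and commutation statements
  the join condition must be pulled back from the bidual. An empty join gives
  \<open>T\<^sub>\<alpha>T\<^sub>\<alpha>\<^sup>*T\<^sub>\<beta>T\<^sub>\<beta>\<^sup>* = 0\<close>; applied to two distinct vertices \<open>v\<close>, \<open>w\<close>, it makes \<open>T\<^sub>v\<close> and \<open>T\<^sub>w\<close>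
  orthogonal, hence \<open>T\<^sub>\<alpha>T\<^sub>\<beta> = T\<^sub>\<alpha>T\<^sub>v T\<^sub>w T\<^sub>\<beta> = 0\<close> when \<open>v\<close> is the source of \<open>\<alpha>\<close> and \<open>w\<close> the range
  of \<open>\<beta>\<close>, and makes the initial projections, which are the \<open>T\<^sub>v\<close>, commute. In general a join is self-adjoint, and a product of two projections is
  self-adjoint iff they commute. Both uses need only that the canonical map into the bidual
  is injective and compatible with the involution (\<open>inj_to_bidual\<close>, \<open>adj_to_bidual\<close>). Injectivity is the
  Hahn-Banach theorem (\<open>exists_norming_functional\<close>).

  Conversely, only \<open>T\<^sub>\<alpha>\<^sup>*T\<^sub>\<alpha> = T\<^sub>v\<close>, with \<open>v\<close> the source of \<open>\<alpha>\<close>, has to be derived. Here \<open>T\<^sub>v\<close> is an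
  idempotent partial isometry and therefore a projection
  (\<open>partial_isometry_idempotent_imp_projection\<close>). From \<open>T\<^sub>\<alpha>T\<^sub>v = T\<^sub>\<alpha>\<close> the projection \<open>p = T\<^sub>\<alpha>\<^sup>*T\<^sub>\<alpha>\<close>
  lies below \<open>q = T\<^sub>v\<close>, so \<open>d = q - p\<close> is a projection, while the domination condition says
  \<open>- d = c\<^sup>*c\<close> for some \<open>c\<close>. That this forces \<open>d = 0\<close> is an instance of the positive cone being
  proper. For projections there is a proof without spectral theory
  (\<open>sum_squares_eq_neg_projection\<close>, \<open>adj_mult_self_eq_neg_projection\<close>): for self-adjoint \<open>a\<close>
  and to first order in small \<open>t > 0\<close>, the element \<open>d - t d a\<^sup>2 d\<close> has norm at most 1, whereas
  \<open>d + t d\<close> has norm \<open>1 + t\<close>.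
\<close>

section \<open>Separation of points by bounded functionals\<close>

definition sublinear :: "('a::real_vector \<Rightarrow> real) \<Rightarrow> bool" where
  "sublinear p \<longleftrightarrow> (\<forall>x y. p (x + y) \<le> p x + p y) \<and> (\<forall>t\<ge>0. \<forall>x. p (t *\<^sub>R x) = t * p x)"

lemma sublinear_add: "sublinear p \<Longrightarrow> p (x + y) \<le> p x + p y"
  unfolding sublinear_def by blast

lemma sublinear_scaleR: "sublinear p \<Longrightarrow> 0 \<le> t \<Longrightarrow> p (t *\<^sub>R x) = t * p x"
  unfolding sublinear_def by blast

lemma sublinear_zero: "sublinear p \<Longrightarrow> p 0 = 0"
  using sublinear_scaleR[of p 0 0] by simp

lemma sublinear_minus_ge: "sublinear p \<Longrightarrow> - p (- x) \<le> p x"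
  using sublinear_add[of p x "- x"] sublinear_zero[of p] by simp

text \<open>Homogeneity only has to be checked as an inequality, because scaling is invertible.\<close>

lemma sublinearI:
  assumes add: "\<And>x y. p (x + y) \<le> p x + p y" and zero: "p 0 = 0"
    and scale: "\<And>t x. 0 < t \<Longrightarrow> p (t *\<^sub>R x) \<le> t * p x"
  shows "sublinear p"
proof -
  have "p (t *\<^sub>R x) = t * p x" if "0 \<le> t" for t x
  proof (cases "t = 0")
    case False
    with that have t: "0 < t" by simp
    have "p x \<le> inverse t * p (t *\<^sub>R x)"
      using scale[of "inverse t" "t *\<^sub>R x"] t by simp
    then have "t * p x \<le> p (t *\<^sub>R x)"
      using t by (simp add: field_simps)
    with scale[OF t, of x] show ?thesis by simp
  qed (simp add: zero)
  then show ?thesis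
    using add unfolding sublinear_def by blast
qed

text \<open>The greatest sublinear functional below \<open>p\<close> whose value at \<open>- y\<close> is at most \<open>- p y\<close>. A
  functional that no tilting can lower is odd, and an odd sublinear functional is linear.\<close>

definition tilt :: "('a::real_vector \<Rightarrow> real) \<Rightarrow> 'a \<Rightarrow> 'a \<Rightarrow> real" where
  "tilt p y x = (INF t\<in>{0..}. p (x + t *\<^sub>R y) - t * p y)"

lemma tilt_le:
  assumes p: "sublinear p" and t: "0 \<le> t"
  shows "tilt p y x \<le> p (x + t *\<^sub>R y) - t * p y"
proof -
  have "- p (- x) \<le> p (x + t *\<^sub>R y) - t * p y" if "0 \<le> t" for t
    using sublinear_add[OF p, of "x + t *\<^sub>R y" "- x"] sublinear_scaleR[OF p that, of y] by simp
  then show ?thesis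
    unfolding tilt_def using t by (intro cINF_lower bdd_belowI2[of _ "- p (- x)"]) auto
qed

lemma tilt_greatest:
  assumes "\<And>t. 0 \<le> t \<Longrightarrow> c \<le> p (x + t *\<^sub>R y) - t * p y"
  shows "c \<le> tilt p y x"
  unfolding tilt_def using assms by (intro cINF_greatest) auto

lemma tilt_le_self: "sublinear p \<Longrightarrow> tilt p y x \<le> p x"
  using tilt_le[of p 0 y x] by simp

lemma tilt_minus_le: "sublinear p \<Longrightarrow> tilt p y (- y) \<le> - p y"
  using tilt_le[of p 1 y "- y"] sublinear_zero[of p] by simp

lemma sublinear_tilt:
  assumes p: "sublinear p"
  shows "sublinear (tilt p y)"
proof (rule sublinearI)
  fix x z
  have *: "tilt p y (x + z) \<le> (p (x + s *\<^sub>R y) - s * p y) + (p (z + t *\<^sub>R y) - t * p y)"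
    if "0 \<le> s" "0 \<le> t" for s t
    using tilt_le[OF p, of "s + t" y "x + z"] that
      sublinear_add[OF p, of "x + s *\<^sub>R y" "z + t *\<^sub>R y"]
    by (simp add: algebra_simps)
  have "tilt p y (x + z) - (p (x + s *\<^sub>R y) - s * p y) \<le> tilt p y z" if "0 \<le> s" for s
    by (rule tilt_greatest) (use *[OF that] in \<open>simp add: algebra_simps\<close>)
  then have "tilt p y (x + z) - tilt p y z \<le> tilt p y x"
    by (intro tilt_greatest) (simp add: algebra_simps)
  then show "tilt p y (x + z) \<le> tilt p y x + tilt p y z" by simp
next
  have "0 \<le> tilt p y 0"
    by (rule tilt_greatest) (simp add: sublinear_scaleR[OF p])
  then show "tilt p y 0 = 0"
    using tilt_le_self[OF p, of y 0] sublinear_zero[OF p] by simp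
next
  fix t :: real and x
  assume t: "0 < t"
  have "tilt p y (t *\<^sub>R x) / t \<le> tilt p y x"
  proof (rule tilt_greatest)
    fix s :: real
    assume s: "0 \<le> s"
    have "tilt p y (t *\<^sub>R x) \<le> p (t *\<^sub>R x + (t * s) *\<^sub>R y) - (t * s) * p y"
      using tilt_le[OF p, of "t * s"] s t by simp
    also have "p (t *\<^sub>R x + (t * s) *\<^sub>R y) = t * p (x + s *\<^sub>R y)"
      using sublinear_scaleR[OF p, of t "x + s *\<^sub>R y"] t by (simp add: scaleR_add_right)
    finally show "tilt p y (t *\<^sub>R x) / t \<le> p (x + s *\<^sub>R y) - s * p y"
      using t by (simp add: field_simps)
  qed
  then show "tilt p y (t *\<^sub>R x) \<le> t * tilt p y x"
    using t by (simp add: field_simps)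
qed

text \<open>The pointwise infimum is a lower bound of the chain within the sublinear functionals, as
  needed for Zorn's lemma; it is finite because \<open>p x \<ge> - p (- x) \<ge> - p0 (- x)\<close> for \<open>p\<close> in the chain.\<close>

lemma sublinear_chain_INF:
  assumes ne: "C \<noteq> {}" and sub: "\<And>p. p \<in> C \<Longrightarrow> sublinear p"
    and chain: "\<And>p q. p \<in> C \<Longrightarrow> q \<in> C \<Longrightarrow> p \<le> q \<or> q \<le> p"
    and bound: "\<And>p. p \<in> C \<Longrightarrow> p \<le> p0"
  shows "sublinear (\<lambda>x. INF p\<in>C. p x)" and "p \<in> C \<Longrightarrow> (INF p\<in>C. p x) \<le> p x"
proof -
  have low: "- p0 (- x) \<le> p x" if "p \<in> C" for p x
    using sublinear_minus_ge[OF sub[OF that], of x] bound[OF that] unfolding le_fun_def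
    by (meson le_minus_iff minus_le_iff order_trans)
  have le: "(INF p\<in>C. p x) \<le> p x" if "p \<in> C" for p x
    using that low by (intro cINF_lower bdd_belowI2[of _ "- p0 (- x)"]) auto
  then show "p \<in> C \<Longrightarrow> (INF p\<in>C. p x) \<le> p x" .
  have zero: "(\<lambda>p. p 0) ` C = {0}"
    using ne sublinear_zero[OF sub] by force
  show "sublinear (\<lambda>x. INF p\<in>C. p x)"
  proof (rule sublinearI)
    fix x y
    let ?I = "\<lambda>x. INF p\<in>C. p x"
    \<comment> \<open>As \<open>C\<close> is a chain, the smaller of \<open>p\<close> and \<open>q\<close> can replace both on the right-hand side.\<close>
    have *: "?I (x + y) \<le> p x + q y" if pq: "p \<in> C" "q \<in> C" for p q
    proof (cases "p \<le> q")
      case True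
      then show ?thesis
        using le[OF pq(1), of "x + y"] sublinear_add[OF sub[OF pq(1)], of x y]
          le_funD[OF True, of y] by linarith
    next
      case False
      then have "q \<le> p" using chain pq by blast
      then show ?thesis
        using le[OF pq(2), of "x + y"] sublinear_add[OF sub[OF pq(2)], of x y]
          le_funD[OF \<open>q \<le> p\<close>, of x] by linarith
    qed
    have "?I (x + y) - p x \<le> ?I y" if "p \<in> C" for p
      using *[OF that] ne by (intro cINF_greatest) (auto simp: algebra_simps)
    then have "?I (x + y) - ?I y \<le> ?I x"
      using ne by (intro cINF_greatest) (auto simp: algebra_simps)
    then show "?I (x + y) \<le> ?I x + ?I y" by simp
  next
    show "(INF p\<in>C. p 0) = 0"
      by (simp add: zero)
  next
    fix t :: real and x
    assume t: "0 < t"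
    have "(INF p\<in>C. p (t *\<^sub>R x)) / t \<le> (INF p\<in>C. p x)"
    proof (rule cINF_greatest[OF ne])
      fix p assume "p \<in> C"
      then show "(INF p\<in>C. p (t *\<^sub>R x)) / t \<le> p x"
        using le[of p "t *\<^sub>R x"] t sublinear_scaleR[OF sub, of p t x] by (simp add: field_simps)
    qed
    then show "(INF p\<in>C. p (t *\<^sub>R x)) \<le> t * (INF p\<in>C. p x)"
      using t by (simp add: field_simps)
  qed
qed

text \<open>The Hahn-Banach theorem, in the form that a minimal sublinear functional is linear: it equals
  all its tilts.\<close>

lemma exists_linear_below_sublinear:
  assumes p0: "sublinear p0"
  obtains f where "linear f" "\<And>x. f x \<le> p0 x"
proof -
  define A where "A = {p. sublinear p \<and> p \<le> p0}"
  have po: "partial_order_on A (relation_of (\<lambda>p q. q \<le> p) A)"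
    unfolding partial_order_on_def preorder_on_def
    by (auto simp: relation_of_def refl_on_def trans_def antisym_def)
  have "\<exists>m\<in>A. \<forall>p\<in>A. p \<le> m \<longrightarrow> p = m"
  proof (rule predicate_Zorn[OF po])
    fix C
    assume C: "C \<in> Chains (relation_of (\<lambda>p q. q \<le> p) A)"
    then have CA: "C \<subseteq> A"
      by (auto simp: Chains_def relation_of_def)
    show "\<exists>u\<in>A. \<forall>a\<in>C. u \<le> a"
    proof (cases "C = {}")
      case True
      then show ?thesis using p0 by (auto simp: A_def)
    next
      case False
      have chain: "p \<le> q \<or> q \<le> p" if "p \<in> C" "q \<in> C" for p q
        using C that by (auto simp: Chains_def relation_of_def)
      have sub: "sublinear p" and bound: "p \<le> p0" if "p \<in> C" for p
        using CA that by (auto simp: A_def)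
      note INF = sublinear_chain_INF[OF False sub chain bound]
      have "(\<lambda>x. INF p\<in>C. p x) \<in> A"
        using False INF bound unfolding A_def le_fun_def by (blast intro: order_trans)
      then show ?thesis
        using INF(2) by (intro bexI[of _ "\<lambda>x. INF p\<in>C. p x"]) (auto simp: le_fun_def)
    qed
  qed
  then obtain f where f: "sublinear f" "f \<le> p0" and min: "\<And>p. sublinear p \<Longrightarrow> p \<le> f \<Longrightarrow> p = f"
    unfolding A_def by (auto intro: order_trans)
  have "tilt f y = f" for y
    using f(1) by (intro min sublinear_tilt) (simp_all add: le_fun_def tilt_le_self)
  then have neg: "f (- y) = - f y" for y
    using tilt_minus_le[OF f(1), of y] sublinear_minus_ge[OF f(1), of y] by simp
  have add: "f (x + y) = f x + f y" for x y
    using sublinear_add[OF f(1), of x y] sublinear_add[OF f(1), of "x + y" "- y"] neg[of y] by simp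
  have "f (t *\<^sub>R x) = t * f x" for t x
    using sublinear_scaleR[OF f(1), of t x] sublinear_scaleR[OF f(1), of "- t" x] neg[of "t *\<^sub>R x"]
    by (cases "0 \<le> t") auto
  then have "linear f"
    by (intro linearI) (simp_all add: add)
  with f(2) that show thesis
    by (auto simp: le_fun_def)
qed

text \<open>Tilting the norm in direction \<open>x0\<close> before taking a linear functional below it forces
  \<open>f (- x0) \<le> - norm x0\<close>, so that no extension from a subspace is involved.\<close>

lemma exists_norming_functional:
  fixes x0 :: "'a::real_normed_vector"
  obtains f where "linear f" "\<And>x. \<bar>f x\<bar> \<le> norm x" "f x0 = norm x0"
proof -
  have norm: "sublinear (norm :: 'a \<Rightarrow> real)"
    by (auto simp: sublinear_def norm_triangle_ineq)
  obtain f where f: "linear f" "\<And>x. f x \<le> tilt norm x0 x"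
    using exists_linear_below_sublinear[OF sublinear_tilt[OF norm]] by metis
  have le: "f x \<le> norm x" for x
    using f(2)[of x] tilt_le_self[OF norm, of x0 x] by simp
  have "\<bar>f x\<bar> \<le> norm x" for x
    using le[of x] le[of "- x"] linear_neg[OF f(1), of x] by simp
  moreover have "f x0 = norm x0"
    using f(2)[of "- x0"] tilt_minus_le[OF norm, of x0] le[of x0] linear_neg[OF f(1), of x0] by simp
  ultimately show thesis
    using f(1) that by blast
qed

section \<open>Elementary facts on C*-algebras\<close>

lemma scaleC_zero_left: "0 *\<^sub>C (x::'a::cstar_algebra) = 0"
  using scaleC_of_real[of 0 x] by simp

lemma scaleC_minus_left: "(- z) *\<^sub>C (x::'a::cstar_algebra) = - (z *\<^sub>C x)"
  using scaleC_add_left[of z "- z" x] by (simp add: scaleC_zero_left eq_neg_iff_add_eq_0 add.commute)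

lemma scaleC_minus_right: "z *\<^sub>C (- x) = - (z *\<^sub>C (x::'a::cstar_algebra))"
  using scaleC_scaleC[of z "- 1" x] scaleC_of_real[of "- 1" x] scaleC_minus_left[of z x] by simp

lemma scaleC_one: "1 *\<^sub>C (x::'a::cstar_algebra) = x"
  using scaleC_of_real[of 1 x] by simp

lemma scaleC_scaleR: "z *\<^sub>C t *\<^sub>R (x::'a::cstar_algebra) = t *\<^sub>R z *\<^sub>C x"
  by (simp add: scaleC_of_real[symmetric] scaleC_scaleC mult.commute)

lemma adj_zero: "adj (0::'a::cstar_algebra) = 0"
  using adj_add[of "0::'a" 0] by simp

lemma adj_minus: "adj (- x) = - adj (x::'a::cstar_algebra)"
  using adj_add[of x "- x"] by (simp add: adj_zero eq_neg_iff_add_eq_0 add.commute)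

lemma adj_diff: "adj (x - y) = adj x - adj (y::'a::cstar_algebra)"
  using adj_add[of x "- y"] by (simp add: adj_minus)

lemma adj_scaleR: "adj (t *\<^sub>R x) = t *\<^sub>R adj (x::'a::cstar_algebra)"
  using adj_scaleC[of "of_real t" x] by (simp add: scaleC_of_real)

lemmas adj_simps = adj_adj adj_add adj_zero adj_minus adj_diff adj_scaleR adj_scaleC adj_mult

lemma adj_mult_self_eq_0_iff: "adj x * x = 0 \<longleftrightarrow> x = (0::'a::cstar_algebra)"
  using cstar_identity[of x] by auto

lemma norm_projection:
  assumes "is_projection (d::'a::cstar_algebra)" "d \<noteq> 0"
  shows "norm d = 1"
  using cstar_identity[of d] assms by (simp add: is_projection_def power2_eq_square)

lemma partial_isometry_projections:
  assumes "is_partial_isometry (u::'a::cstar_algebra)"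
  shows "is_projection (adj u * u)" "is_projection (u * adj u)"
  using assms unfolding is_partial_isometry_def is_projection_def
  by (simp_all add: adj_simps) (metis mult.assoc)+

text \<open>The element \<open>z = e - e e\<^sup>*\<close>, which measures the failure of \<open>e\<close> to be its own range
  projection, satisfies \<open>z z\<^sup>* = 0\<close>.\<close>

lemma partial_isometry_idempotent_imp_projection:
  fixes e :: "'a::cstar_algebra"
  assumes pi: "is_partial_isometry e" and idem: "e * e = e"
  shows "is_projection e"
proof -
  have 1: "e * (adj e * e) = e" "e * (adj e * (e * x)) = e * x" for x
    using pi unfolding is_partial_isometry_def by (metis mult.assoc)+
  have 2: "e * (e * x) = e * x" for x
    by (metis idem mult.assoc)
  have 3: "adj e * adj e = adj e" using idem by (metis adj_mult)
  have "adj (adj (e - e * adj e)) * adj (e - e * adj e) = 0"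
    by (simp add: adj_simps algebra_simps idem 1 2 3)
  then have "e = e * adj e"
    by (metis adj_mult_self_eq_0_iff adj_adj adj_zero eq_iff_diff_eq_0)
  then have "adj e = e"
    by (metis adj_mult adj_adj)
  with idem show ?thesis by (simp add: is_projection_def)
qed

text \<open>To second order in \<open>s\<close>, the exponential of \<open>i s a\<close> is \<open>1 + i s a - (s\<^sup>2/2) a\<^sup>2\<close>, and this has norm
  \<open>1 + O(s\<^sup>4)\<close>: multiplied by its adjoint it gives \<open>1 + (s\<^sup>4/4) a\<^sup>4\<close>. Its real part, compressed by
  \<open>d\<close>, is the element to be estimated, with \<open>c = s\<^sup>2/2\<close>. Multiplying on the right by \<open>d\<close>
  keeps everything inside an algebra that may lack a unit. What matters is that the
  deviation from 1 is quadratic in \<open>c\<close>.\<close>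

lemma norm_projection_minus_square_le:
  fixes d a :: "'a::cstar_algebra"
  assumes d: "is_projection d" "d \<noteq> 0" and a: "adj a = a" and c: "0 \<le> c"
  shows "norm (d - c *\<^sub>R (d * a * a * d)) \<le> 1 + c^2 / 2 * norm a ^ 4"
proof -
  have dd: "d * d = d" "adj d = d" "d * (d * x) = d * x" for x
    using d by (auto simp: is_projection_def mult.assoc[symmetric])
  have nd: "norm d = 1" using norm_projection[OF d] .
  define s where "s = sqrt (2 * c)"
  have s: "s * s = 2 * c" using c by (simp add: s_def)
  define b where "b = \<i> *\<^sub>C a"
  have b: "adj b = - b" "b * b = - (a * a)" "b * a = a * b" "b * (b * y) = - (a * (a * y))"
    "b * (a * y) = a * (b * y)" for y
    by (simp_all add: b_def adj_scaleC a scaleC_minus_left mult_scaleC_left mult_scaleC_right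
        scaleC_scaleC scaleC_one mult.assoc)
  define u where "u = s *\<^sub>R (b * d)"
  define v where "v = d - c *\<^sub>R (a * a * d)"
  \<comment> \<open>\<open>x\<close> is the second-order exponential times \<open>d\<close>; \<open>u\<close> collects its odd part and \<open>v\<close> its even part.\<close>
  define x where "x = v + u"
  have uu: "adj u * u = (2 * c) *\<^sub>R (d * a * a * d)"
    by (simp add: u_def adj_simps dd b s mult.assoc)
  have uv: "adj u * v + adj v * u = 0"
    by (simp add: u_def v_def adj_simps dd a b algebra_simps)
  have vv: "adj v * v = d - (2 * c) *\<^sub>R (d * a * a * d) + (c * c) *\<^sub>R (d * a * a * a * a * d)"
    by (simp add: v_def adj_simps dd a algebra_simps flip: scaleR_add_left)
  have "adj x * x = d + (c * c) *\<^sub>R (d * a * a * a * a * d)"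
    using uu uv vv by (simp add: x_def adj_add algebra_simps)
  then have "norm x ^ 2 = norm (d + (c * c) *\<^sub>R (d * a * a * a * a * d))"
    by (simp add: cstar_identity[symmetric])
  also have "\<dots> \<le> 1 + (c * c) * norm (d * a * a * a * a * d)"
    using norm_triangle_ineq[of d "(c * c) *\<^sub>R (d * a * a * a * a * d)"] nd by simp
  also have "\<dots> \<le> 1 + (c * c) * (norm d * norm a * norm a * norm a * norm a * norm d)"
    by (intro add_left_mono mult_left_mono order_trans[OF norm_mult_ineq] mult_mono norm_mult_ineq
        order_refl norm_ge_zero mult_nonneg_nonneg c)
  finally have "norm x ^ 2 \<le> 1 + c^2 * norm a ^ 4"
    using nd by (simp add: power2_eq_square power4_eq_xxxx mult.assoc)
  also have "\<dots> \<le> (1 + c^2 / 2 * norm a ^ 4)^2"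
    by (simp add: power2_sum)
  finally have nx: "norm x \<le> 1 + c^2 / 2 * norm a ^ 4"
    by (rule power2_le_imp_le) simp
  have "(1/2) *\<^sub>R (d * x + adj (d * x)) = d - c *\<^sub>R (d * a * a * d)"
    by (simp add: x_def u_def v_def adj_simps dd a b algebra_simps flip: scaleR_add_left)
  then have "norm (d - c *\<^sub>R (d * a * a * d)) = 1/2 * norm (d * x + adj (d * x))"
    by (metis norm_scaleR abs_of_nonneg zero_le_divide_1_iff zero_le_numeral)
  also have "\<dots> \<le> 1/2 * (norm (d * x) + norm (adj (d * x)))"
    by (intro mult_left_mono norm_triangle_ineq) simp
  also have "\<dots> = norm (d * x)" by (simp add: norm_adj)
  also have "\<dots> \<le> norm x" using norm_mult_ineq[of d x] nd by simp
  finally show ?thesis using nx by simp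
qed

text \<open>Summing the estimates for the \<open>n\<close> squares gives \<open>norm (n d + c d) \<le> n + O(c\<^sup>2)\<close>, while the left-hand
  side is \<open>n + c\<close> if \<open>d \<noteq> 0\<close>. This fails for small \<open>c > 0\<close>.\<close>

lemma sum_squares_eq_neg_projection:
  fixes d :: "'a::cstar_algebra"
  assumes d: "is_projection d" and sa: "\<And>a. a \<in> set as \<Longrightarrow> adj a = a"
    and sum: "(\<Sum>a\<leftarrow>as. a * a) = - d"
  shows "d = 0"
proof (rule ccontr)
  assume nz: "d \<noteq> 0"
  have dd: "d * d = d" using d by (simp add: is_projection_def)
  have nd: "norm d = 1" using norm_projection[OF d nz] .
  define M where "M = (\<Sum>a\<leftarrow>as. norm a ^ 4)"
  have M: "0 \<le> M" unfolding M_def by (rule sum_list_nonneg) auto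
  have key: "c \<le> c^2 / 2 * M" if c: "0 \<le> c" for c
  proof -
    have 1: "norm (real (length bs) *\<^sub>R d - c *\<^sub>R (d * (\<Sum>a\<leftarrow>bs. a * a) * d))
          \<le> real (length bs) + c^2 / 2 * (\<Sum>a\<leftarrow>bs. norm a ^ 4)"
      if "\<And>a. a \<in> set bs \<Longrightarrow> adj a = a" for bs :: "'a list"
      using that
    proof (induction bs)
      case (Cons b bs)
      have "real (length (b # bs)) *\<^sub>R d - c *\<^sub>R (d * (\<Sum>a\<leftarrow>b # bs. a * a) * d)
          = (d - c *\<^sub>R (d * b * b * d))
            + (real (length bs) *\<^sub>R d - c *\<^sub>R (d * (\<Sum>a\<leftarrow>bs. a * a) * d))"
        by (simp add: algebra_simps)
      then show ?case
        using norm_triangle_mono[OF norm_projection_minus_square_le[OF d nz, of b] Cons.IH] Cons.prems c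
        by (simp add: algebra_simps)
    qed simp
    have "real (length as) *\<^sub>R d - c *\<^sub>R (d * (\<Sum>a\<leftarrow>as. a * a) * d) = (real (length as) + c) *\<^sub>R d"
      by (simp add: sum dd algebra_simps)
    then show ?thesis
      using 1[of as] sa nd c by (simp add: M_def)
  qed
  \<comment> \<open>Any \<open>c > 0\<close> with \<open>c M < 2\<close> contradicts \<open>key\<close>.\<close>
  define c where "c = 1 / (M + 1)"
  have c: "0 < c" "c * M < 1" using M by (auto simp: c_def field_simps)
  from key[of c] c(1) have "2 \<le> c * M" by (simp add: power2_eq_square field_simps)
  with c(2) show False by simp
qed

text \<open>Necessarily \<open>w d = w\<close>, so \<open>f = - w w\<^sup>*\<close> is a projection as well. With \<open>h\<close> and \<open>k\<close> the real and
  imaginary parts of \<open>w\<close>, the identity \<open>2 h\<^sup>2 + 2 k\<^sup>2 = w\<^sup>*w + w w\<^sup>* = - d - f\<close> exhibits \<open>- d\<close> as the sum of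
  squares \<open>2 h\<^sup>2 + 2 k\<^sup>2 + f\<^sup>2\<close>.\<close>

lemma adj_mult_self_eq_neg_projection:
  fixes w d :: "'a::cstar_algebra"
  assumes d: "is_projection d" and w: "adj w * w = - d"
  shows "d = 0"
proof -
  have dd: "d * d = d" "adj d = d" "d * (d * x) = d * x" for x
    using d by (auto simp: is_projection_def mult.assoc[symmetric])
  have w': "adj w * (w * x) = - (d * x)" for x using w by (metis mult.assoc mult_minus_left)
  have "adj (w - w * d) * (w - w * d) = 0"
    by (simp add: adj_simps algebra_simps w w' dd)
  then have wd: "w * d = w" by (simp add: adj_mult_self_eq_0_iff)
  have wd': "w * (d * x) = w * x" for x using wd by (metis mult.assoc)
  define f where "f = - (w * adj w)"
  define h where "h = (1/2) *\<^sub>R (w + adj w)"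
  \<comment> \<open>This is minus the imaginary part; the sign does not affect \<open>k\<^sup>2\<close>.\<close>
  define k where "k = \<i> *\<^sub>C ((1/2) *\<^sub>R (w - adj w))"
  have "adj f = f" "adj h = h"
    by (simp_all add: f_def h_def adj_simps add.commute)
  moreover have "adj k = k"
    using scaleC_minus_right[of \<i> "(1/2) *\<^sub>R (w - adj w)"]
    by (simp add: k_def adj_simps scaleC_minus_left flip: scaleR_minus_right)
  moreover have "f * f = f"
    by (simp add: f_def algebra_simps w' wd')
  moreover have "h * h + (k * k + (h * h + k * k)) = adj w * w + w * adj w"
  proof -
    have k2: "k * k = - (((1/2) *\<^sub>R (w - adj w)) * ((1/2) *\<^sub>R (w - adj w)))"
      unfolding k_def mult_scaleC_left mult_scaleC_right scaleC_scaleC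
      by (simp add: scaleC_minus_left scaleC_one)
    have "h * h + k * k = (1/2) *\<^sub>R (adj w * w + w * adj w)"
      unfolding k2 h_def by (simp add: algebra_simps flip: scaleR_add_left)
    then show ?thesis
      by (simp add: add.assoc[symmetric]) (simp add: algebra_simps flip: scaleR_add_left)
  qed
  ultimately show ?thesis
    using sum_squares_eq_neg_projection[OF d, of "[h, k, h, k, f]"] w
    by (auto simp: f_def algebra_simps)
qed

section \<open>The canonical map into the bidual\<close>

lemma to_bidual_zero: "to_bidual (0::'a::cstar_algebra) = 0"
proof -
  have "cdual_apply f 0 = 0" for f :: "'a cdual"
    using cdual_apply_bound[of f 0] by simp
  then show ?thesis
    by (simp add: bidual_apply_inject[symmetric] to_bidual.rep_eq zero_bidual.rep_eq)
qed

lemma adj_to_bidual: "adj (to_bidual (x::'a::cstar_algebra)) = to_bidual (adj x)"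
  by (simp add: bidual_apply_inject[symmetric] fun_eq_iff adj_bidual.rep_eq to_bidual.rep_eq
      cdual_adj.rep_eq)

lemma inj_to_bidual: "inj (to_bidual :: 'a::cstar_algebra \<Rightarrow> _)"
proof (rule injI)
  fix x y :: 'a
  assume eq: "to_bidual x = to_bidual y"
  obtain f :: "'a \<Rightarrow> real" where f: "linear f" "\<And>z. \<bar>f z\<bar> \<le> norm z" "f (x - y) = norm (x - y)"
    using exists_norming_functional by blast
  \<comment> \<open>The unique complex linear functional with real part \<open>f\<close>.\<close>
  define g where "g z = complex_of_real (f z) - \<i> * complex_of_real (f (\<i> *\<^sub>C z))" for z
  have g: "bounded_clinear norm g"
  proof (rule bounded_clinearI)
    fix z
    have "cmod (g z) \<le> \<bar>f z\<bar> + \<bar>f (\<i> *\<^sub>C z)\<bar>"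
      unfolding g_def by (rule order_trans[OF norm_triangle_ineq4]) (simp add: norm_mult)
    also have "\<dots> \<le> norm z * 2"
      using f(2)[of z] f(2)[of "\<i> *\<^sub>C z"] by (simp add: norm_scaleC)
    finally show "cmod (g z) \<le> norm z * 2" .
  next
    show "g (z + z') = g z + g z'" for z z'
      by (simp add: g_def scaleC_add_right linear_add[OF f(1)] algebra_simps)
  next
    fix c z
    have c: "c *\<^sub>C z = Re c *\<^sub>R z + Im c *\<^sub>R (\<i> *\<^sub>C z)" for z :: 'a
      by (simp add: scaleC_of_real[symmetric] scaleC_scaleC scaleC_add_left[symmetric]
          complex_eq[of c, symmetric] mult.commute)
    have i: "\<i> *\<^sub>C \<i> *\<^sub>C z = - z" for z :: 'a
      by (simp add: scaleC_scaleC scaleC_minus_left scaleC_one)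
    have 1: "f (c *\<^sub>C z) = Re c * f z + Im c * f (\<i> *\<^sub>C z)"
      by (subst c) (simp add: linear_add[OF f(1)] linear_scale[OF f(1)])
    have 2: "f (\<i> *\<^sub>C c *\<^sub>C z) = Re c * f (\<i> *\<^sub>C z) - Im c * f z"
      by (subst c) (simp add: scaleC_add_right scaleC_scaleR i linear_add[OF f(1)]
          linear_scale[OF f(1)] linear_neg[OF f(1)] linear_diff[OF f(1)])
    show "g (c *\<^sub>C z) = c * g z"
      unfolding g_def 1 2 by (simp add: complex_eq_iff algebra_simps)
  qed
  have "cdual_apply (Abs_cdual g) x = cdual_apply (Abs_cdual g) y"
    using eq by (metis to_bidual.rep_eq)
  then have "g x = g y"
    using g by (simp add: Abs_cdual_inverse)
  then have "f x = f y"
    by (simp add: g_def complex_eq_iff)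
  then show "x = y"
    using f(3) linear_diff[OF f(1), of x y] by simp
qed

section \<open>Common extensions and the join condition\<close>

lemma extensions_mono:
  assumes "small_category \<C>" "\<gamma>' \<in> mor \<C>" "\<gamma> \<in> extensions \<C> \<gamma>'"
  shows "extensions \<C> \<gamma> \<subseteq> extensions \<C> \<gamma>'"
proof
  fix \<delta>
  assume "\<delta> \<in> extensions \<C> \<gamma>"
  then obtain \<beta> where \<beta>: "\<delta> = cmp \<C> \<gamma> \<beta>" "\<beta> \<in> mor \<C>" "rng \<C> \<beta> = src \<C> \<gamma>"
    unfolding extensions_def by blast
  obtain \<beta>' where \<beta>': "\<gamma> = cmp \<C> \<gamma>' \<beta>'" "\<beta>' \<in> mor \<C>" "rng \<C> \<beta>' = src \<C> \<gamma>'"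
    using assms(3) unfolding extensions_def by blast
  have "src \<C> \<gamma> = src \<C> \<beta>'"
    using assms(1,2) \<beta>' unfolding small_category_def by simp
  then have "\<delta> = cmp \<C> \<gamma>' (cmp \<C> \<beta>' \<beta>)" "cmp \<C> \<beta>' \<beta> \<in> mor \<C>" "rng \<C> (cmp \<C> \<beta>' \<beta>) = src \<C> \<gamma>'"
    using assms(1,2) \<beta> \<beta>' unfolding small_category_def by simp_all
  then show "\<delta> \<in> extensions \<C> \<gamma>'"
    unfolding extensions_def by blast
qed

text \<open>A finite generating set of least cardinality is independent, because a generator that
  extends another one is redundant.\<close>

lemma exists_vee:
  assumes cat: "small_category \<C>" and fa: "finitely_aligned \<C>"
    and "\<alpha> \<in> mor \<C>" "\<beta> \<in> mor \<C>"
  obtains F where "is_vee \<C> \<alpha> \<beta> F"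
proof -
  define P where "P F \<longleftrightarrow> finite F \<and> F \<subseteq> mor \<C> \<and>
    extensions \<C> \<alpha> \<inter> extensions \<C> \<beta> = (\<Union>\<gamma>\<in>F. extensions \<C> \<gamma>)" for F
  have "\<exists>F. P F"
    using fa assms(3,4) by (simp add: finitely_aligned_def P_def)
  then obtain F0 where "P F0" ..
  define F where "F = arg_min card P"
  have F: "P F" and min: "\<And>G. P G \<Longrightarrow> card F \<le> card G"
    using arg_min_nat_lemma[of P F0 card] \<open>P F0\<close> unfolding F_def by simp_all
  have "independent_set \<C> F"
    unfolding independent_set_def
  proof (intro ballI impI notI)
    fix \<gamma> \<gamma>'
    assume g: "\<gamma> \<in> F" "\<gamma>' \<in> F" "\<gamma> \<noteq> \<gamma>'" "\<gamma> \<in> extensions \<C> \<gamma>'"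
    have "extensions \<C> \<gamma> \<subseteq> extensions \<C> \<gamma>'"
      using extensions_mono[OF cat _ g(4)] F g(2) by (auto simp: P_def)
    then have "(\<Union>\<delta>\<in>F. extensions \<C> \<delta>) = (\<Union>\<delta>\<in>F - {\<gamma>}. extensions \<C> \<delta>)"
      using g by auto
    then have "P (F - {\<gamma>})"
      using F unfolding P_def by auto
    from min[OF this] show False
      using F g(1) card_Diff1_less[of F \<gamma>] unfolding P_def by simp
  qed
  with F show thesis
    by (intro that[of F]) (simp add: P_def is_vee_def)
qed

text \<open>A join is by definition a projection or \<open>0\<close>, and self-adjointness descends from the bidual.
  A choice of \<open>\<alpha> \<or> \<beta>\<close> is needed here because the join condition quantifies over all such choices.\<close>

lemma join_condition_selfadjoint:
  assumes "small_category \<C>" "finitely_aligned \<C>" "\<alpha> \<in> mor \<C>" "\<beta> \<in> mor \<C>"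
    and join: "join_condition \<C> T \<alpha> \<beta>"
  shows "adj (T \<alpha> * adj (T \<alpha>) * (T \<beta> * adj (T \<beta>))) = T \<alpha> * adj (T \<alpha>) * (T \<beta> * adj (T \<beta>))"
    (is "adj ?x = ?x")
proof -
  obtain F where "is_vee \<C> \<alpha> \<beta> F"
    using exists_vee assms by metis
  with join have "is_projection (to_bidual ?x) \<or> to_bidual ?x = 0"
    unfolding join_condition_def is_join_def by (meson empty_is_image)
  then show ?thesis
  proof
    assume "is_projection (to_bidual ?x)"
    then have "to_bidual (adj ?x) = to_bidual ?x"
      by (simp only: is_projection_def adj_to_bidual)
    then show ?thesis by (rule injD[OF inj_to_bidual])
  next
    assume "to_bidual ?x = 0"
    then have "to_bidual ?x = to_bidual 0" by (simp only: to_bidual_zero)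
    then have "?x = 0" by (rule injD[OF inj_to_bidual])
    then show ?thesis by (simp add: adj_zero)
  qed
qed

lemma join_condition_disjoint:
  assumes join: "join_condition \<C> T \<alpha> \<beta>" and "extensions \<C> \<alpha> \<inter> extensions \<C> \<beta> = {}"
  shows "T \<alpha> * adj (T \<alpha>) * (T \<beta> * adj (T \<beta>)) = 0"
proof -
  have "is_vee \<C> \<alpha> \<beta> {}"
    using assms(2) by (simp add: is_vee_def independent_set_def)
  with join have "to_bidual (T \<alpha> * adj (T \<alpha>) * (T \<beta> * adj (T \<beta>))) = to_bidual 0"
    unfolding join_condition_def is_join_def to_bidual_zero by fastforce
  then show ?thesis by (rule injD[OF inj_to_bidual])
qed

section \<open>The two descriptions of representations\<close>

theorem theorem3p9:
  fixes \<C> :: "'c cat" and T :: "'c \<Rightarrow> 'b::cstar_algebra"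
  assumes "small_category \<C>" and "left_cancellative \<C>" and "finitely_aligned \<C>"
  shows "is_representation \<C> T \<longleftrightarrow>
     (\<forall>\<alpha>\<in>mor \<C>. is_partial_isometry (T \<alpha>)) \<and>
     (\<forall>\<alpha>\<in>mor \<C>. \<forall>\<beta>\<in>mor \<C>.
        T \<alpha> * T \<beta> = (if src \<C> \<alpha> = rng \<C> \<beta> then T (cmp \<C> \<alpha> \<beta>) else 0)) \<and>
     ((\<forall>\<alpha>\<in>mor \<C>. \<forall>\<beta>\<in>mor \<C>.
         (adj (T \<alpha>) * T \<alpha>) * (adj (T \<beta>) * T \<beta>) = (adj (T \<beta>) * T \<beta>) * (adj (T \<alpha>) * T \<alpha>)) \<and>
      (\<forall>\<alpha>\<in>mor \<C>. \<forall>\<beta>\<in>mor \<C>.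
         (T \<alpha> * adj (T \<alpha>)) * (T \<beta> * adj (T \<beta>)) = (T \<beta> * adj (T \<beta>)) * (T \<alpha> * adj (T \<alpha>)))) \<and>
     (\<forall>\<alpha>\<in>mor \<C>. \<forall>\<beta>\<in>mor \<C>. extensions \<C> \<alpha> \<inter> extensions \<C> \<beta> = {} \<longrightarrow>
        (T \<alpha> * adj (T \<alpha>)) * (T \<beta> * adj (T \<beta>)) = 0) \<and>
     (\<forall>\<alpha>\<in>mor \<C>. \<forall>\<beta>\<in>mor \<C>. src \<C> \<alpha> = rng \<C> \<beta> \<longrightarrow>
        cstar_le (T \<beta> * adj (T \<beta>)) (adj (T \<alpha>) * T \<alpha>)) \<and>
     (\<forall>\<alpha>\<in>mor \<C>. \<forall>\<beta>\<in>mor \<C>. join_condition \<C> T \<alpha> \<beta>)"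
    (is "_ \<longleftrightarrow> ?pi \<and> ?mult \<and> (?initial \<and> ?final) \<and> ?disj \<and> ?le \<and> ?join")
proof -
  note cat = assms(1)
  have rs: "rng \<C> \<alpha> \<in> obj \<C>" "src \<C> \<alpha> \<in> obj \<C>" "cmp \<C> (rng \<C> \<alpha>) \<alpha> = \<alpha>" "cmp \<C> \<alpha> (src \<C> \<alpha>) = \<alpha>"
    if "\<alpha> \<in> mor \<C>" for \<alpha>
    using cat that unfolding small_category_def by auto
  have obj: "v \<in> mor \<C>" "rng \<C> v = v" "src \<C> v = v" if "v \<in> obj \<C>" for v
    using cat that unfolding small_category_def by auto
  have obj_idem: "cmp \<C> v v = v" if "v \<in> obj \<C>" for v
    using rs(3)[of v] obj[OF that] by simp
  have disj_obj: "extensions \<C> v \<inter> extensions \<C> w = {}" if "v \<in> obj \<C>" "w \<in> obj \<C>" "v \<noteq> w" for v w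
    using cat that obj unfolding small_category_def extensions_def by auto
  show ?thesis
  proof
    assume "is_representation \<C> T"
    then have init: "\<And>\<alpha>. \<alpha> \<in> mor \<C> \<Longrightarrow> adj (T \<alpha>) * T \<alpha> = T (src \<C> \<alpha>)"
      and mult: "\<And>\<alpha> \<beta>. \<alpha> \<in> mor \<C> \<Longrightarrow> \<beta> \<in> mor \<C> \<Longrightarrow> src \<C> \<alpha> = rng \<C> \<beta> \<Longrightarrow> T \<alpha> * T \<beta> = T (cmp \<C> \<alpha> \<beta>)"
      and join: "\<And>\<alpha> \<beta>. \<alpha> \<in> mor \<C> \<Longrightarrow> \<beta> \<in> mor \<C> \<Longrightarrow> join_condition \<C> T \<alpha> \<beta>"
      unfolding is_representation_def by blast+
    have Ts: "T \<alpha> * T (src \<C> \<alpha>) = T \<alpha>" and Tr: "T (rng \<C> \<alpha>) * T \<alpha> = T \<alpha>" if "\<alpha> \<in> mor \<C>" for \<alpha>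
      using mult rs obj that by metis+
    have idem: "T v * T v = T v" and sa: "adj (T v) = T v" if "v \<in> obj \<C>" for v
    proof -
      show "T v * T v = T v" using mult obj obj_idem that by metis
      show "adj (T v) = T v" using init[of v] obj[OF that] adj_mult[of "adj (T v)" "T v"] by (simp add: adj_adj)
    qed
    have orth: "T v * T w = 0" if "v \<in> obj \<C>" "w \<in> obj \<C>" "v \<noteq> w" for v w
      using join_condition_disjoint[OF join disj_obj] that obj by (simp add: idem sa)
    have ?pi
      by (simp add: is_partial_isometry_def mult.assoc init Ts)
    moreover have ?mult
    proof (intro ballI)
      fix \<alpha> \<beta>
      assume ab: "\<alpha> \<in> mor \<C>" "\<beta> \<in> mor \<C>"
      have "T \<alpha> * T \<beta> = T \<alpha> * (T (src \<C> \<alpha>) * T (rng \<C> \<beta>)) * T \<beta>"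
        using Ts[OF ab(1)] Tr[OF ab(2)] by (metis mult.assoc)
      then show "T \<alpha> * T \<beta> = (if src \<C> \<alpha> = rng \<C> \<beta> then T (cmp \<C> \<alpha> \<beta>) else 0)"
        using mult[OF ab] orth rs ab by (cases "src \<C> \<alpha> = rng \<C> \<beta>") simp_all
    qed
    moreover have ?initial
      using init orth rs by metis
    moreover have ?final
      using join_condition_selfadjoint[OF assms(1,3) _ _ join] by (simp add: adj_mult adj_adj)
    moreover have ?disj
      using join_condition_disjoint[OF join] by blast
    moreover have ?le
    proof (intro ballI impI)
      fix \<alpha> \<beta>
      assume ab: "\<alpha> \<in> mor \<C>" "\<beta> \<in> mor \<C>" "src \<C> \<alpha> = rng \<C> \<beta>"
      define v q where "v = T (rng \<C> \<beta>)" and "q = T \<beta> * adj (T \<beta>)"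
      have v: "v * v = v" "adj v = v" using idem sa rs ab by (auto simp: v_def)
      have q: "q * q = q" "adj q = q"
        using partial_isometry_projections(2) \<open>?pi\<close> ab(2) unfolding q_def is_projection_def by blast+
      have vq: "v * q = q"
        using Tr[OF ab(2)] unfolding v_def q_def by (metis mult.assoc)
      then have qv: "q * v = q" using v q by (metis adj_mult)
      \<comment> \<open>A projection is its own square root.\<close>
      have "v - q = adj (v - q) * (v - q)"
        by (simp add: adj_diff algebra_simps v q vq qv)
      then show "cstar_le (T \<beta> * adj (T \<beta>)) (adj (T \<alpha>) * T \<alpha>)"
        unfolding cstar_le_def init[OF ab(1)] ab(3) v_def q_def by blast
    qed
    moreover have ?join
      using join by blast
    ultimately show "?pi \<and> ?mult \<and> (?initial \<and> ?final) \<and> ?disj \<and> ?le \<and> ?join"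
      by blast
  next
    assume R: "?pi \<and> ?mult \<and> (?initial \<and> ?final) \<and> ?disj \<and> ?le \<and> ?join"
    then have pi: "\<And>\<alpha>. \<alpha> \<in> mor \<C> \<Longrightarrow> is_partial_isometry (T \<alpha>)" and join: ?join by blast+
    have mult: "T \<alpha> * T \<beta> = T (cmp \<C> \<alpha> \<beta>)" if "\<alpha> \<in> mor \<C>" "\<beta> \<in> mor \<C>" "src \<C> \<alpha> = rng \<C> \<beta>" for \<alpha> \<beta>
      using R that by simp
    have "adj (T \<alpha>) * T \<alpha> = T (src \<C> \<alpha>)" if a: "\<alpha> \<in> mor \<C>" for \<alpha>
    proof -
      define p q where "p = adj (T \<alpha>) * T \<alpha>" and "q = T (src \<C> \<alpha>)"
      have s: "src \<C> \<alpha> \<in> mor \<C>" "rng \<C> (src \<C> \<alpha>) = src \<C> \<alpha>"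
        using rs[OF a] obj by auto
      have q: "is_projection q"
        unfolding q_def
        using mult[OF s(1) s(1)] obj obj_idem rs[OF a] by (intro partial_isometry_idempotent_imp_projection pi) auto
      have p: "is_projection p"
        unfolding p_def using partial_isometry_projections pi a by blast
      have pq: "p * q = p"
        using mult[OF a s(1)] rs[OF a] s unfolding p_def q_def by (simp add: mult.assoc)
      then have "q * p = p"
        using p q unfolding is_projection_def by (metis adj_mult)
      then have d: "is_projection (q - p)"
        using p q pq unfolding is_projection_def by (simp add: adj_diff algebra_simps)
      have "cstar_le (T (src \<C> \<alpha>) * adj (T (src \<C> \<alpha>))) (adj (T \<alpha>) * T \<alpha>)"
        using R a s by simp
      then obtain c where "adj c * c = - (q - p)"
        using q unfolding cstar_le_def is_projection_def p_def q_def by auto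
      then have "q - p = 0"
        using adj_mult_self_eq_neg_projection[OF d] by blast
      then show ?thesis by (simp add: p_def q_def)
    qed
    with mult join show "is_representation \<C> T"
      unfolding is_representation_def by blast
  qed
qed

end
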